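(* Let $F=(F_1,\ldots,F_n)$ be an $n$-tuple of formal power series in noncommuting indeterminates $Z_1,\ldots,Z_n$ with complex coefficients. Then the following statements are equivalent. (i) There is an $n$-tuple of formal power series $G=(G_1,\ldots,G_n)$ in $Z_1,\ldots,Z_n$ such that $G(0)=0$ and $F\circ G=\mathrm{id}$. (ii) $F(0)=0$ and $\det J_F(0)\neq 0$. In this case, $G$ is unique and $G\circ F=\mathrm{id}$.
   Context: $\mathbb F_n^+$ is the free semigroup on generators $g_1,\ldots,g_n$ with identity $g_0$; for $\alpha=g_{i_1}\cdots g_{i_k}$ put $Z_\alpha=Z_{i_1}\cdots Z_{i_k}$, $Z_{g_0}=I$. A formal power series is a formal sum $\sum_{\alpha\in\mathbb F_n^+}a_\alpha Z_\alpha$ with $a_\alpha\in\mathbb C$; its value at $0$ is its constant coefficient $a_{g_0}$. If $G=(G_1,\ldots,G_n)$ satisfies $G(0)=0$ (i.e. all $G_i(0)=0$) and $H=\sum_\alpha c_\alpha Z_\alpha$, then $H\circ G:=\sum_\alpha c_\alpha G_\alpha$, where $G_\alpha=G_{i_1}\cdots G_{i_k}$; for tuples, composition is componentwise. $\mathrm{id}=(Z_1,\ldots,Z_n)$. $J_F(0)$ is the $n\times n$ complex matrix whose $(i,j)$ entry is the coefficient of $Z_j$ in $F_i$ (that is, $\partial F_i/\partial Z_j$ at $Z=0$). *)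

theory Defs
  imports "HOL-Analysis.Analysis" "HOL-Library.Groups_Big_Fun"
begin

text \<open>
  The number of indeterminates is the cardinality of the finite type \<open>'n\<close>. The free semigroup
  with identity on the generators is \<open>'n list\<close> (identity \<open>[]\<close>, product \<open>@\<close>), and a formal power
  series is its family of coefficients, indexed by words.
\<close>

type_synonym 'n ncfps = "'n list \<Rightarrow> complex"

definition nc_one :: "'n ncfps" where
  "nc_one w = (if w = [] then 1 else 0)"

definition nc_var :: "'n \<Rightarrow> 'n ncfps" where
  "nc_var i w = (if w = [i] then 1 else 0)"

text \<open>Cauchy product: the coefficient at \<open>w\<close> runs over all factorizations \<open>w = u @ v\<close>.\<close>

definition nc_mult :: "'n ncfps \<Rightarrow> 'n ncfps \<Rightarrow> 'n ncfps" where
  "nc_mult f g w = (\<Sum>k\<le>length w. f (take k w) * g (drop k w))"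

fun nc_word :: "('n \<Rightarrow> 'n ncfps) \<Rightarrow> 'n list \<Rightarrow> 'n ncfps" where
  "nc_word G [] = nc_one"
| "nc_word G (i # \<alpha>) = nc_mult (G i) (nc_word G \<alpha>)"

definition nc_vanishes_at_0 :: "('n \<Rightarrow> 'n ncfps) \<Rightarrow> bool" where
  "nc_vanishes_at_0 G \<longleftrightarrow> (\<forall>i. G i [] = 0)"

text \<open>
  \<open>Sum_any\<close> is the sum over the support and returns 0 if the support is infinite. If all the
  \<open>G i\<close> have zero constant coefficient, only words \<open>\<alpha>\<close> of length at most \<open>length w\<close> contribute
  (see \<open>finite_support_nc_compose\<close>), so this is the formal sum of the series \<open>H \<alpha>\<close> times
  \<open>nc_word G \<alpha>\<close>. No meaning is attached to the value for other \<open>G\<close>.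
\<close>

definition nc_compose1 :: "'n ncfps \<Rightarrow> ('n \<Rightarrow> 'n ncfps) \<Rightarrow> 'n ncfps" where
  "nc_compose1 H G w = Sum_any (\<lambda>\<alpha>. H \<alpha> * nc_word G \<alpha> w)"

definition nc_compose :: "('n \<Rightarrow> 'n ncfps) \<Rightarrow> ('n \<Rightarrow> 'n ncfps) \<Rightarrow> ('n \<Rightarrow> 'n ncfps)" where
  "nc_compose F G = (\<lambda>i. nc_compose1 (F i) G)"

definition nc_id :: "'n \<Rightarrow> 'n ncfps" where
  "nc_id = nc_var"

definition nc_jacobian_0 :: "('n::finite \<Rightarrow> 'n ncfps) \<Rightarrow> complex ^ 'n ^ 'n" where
  "nc_jacobian_0 F = (\<chi> i j. F i [j])"

lemma nc_word_eq_0: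
  assumes "nc_vanishes_at_0 G" and "length w < length \<alpha>"
  shows "nc_word G \<alpha> w = 0"
  using assms(2)
proof (induction \<alpha> arbitrary: w)
  case (Cons i \<alpha>)
  have "G i (take k w) * nc_word G \<alpha> (drop k w) = 0" if "k \<le> length w" for k
  proof (cases "k = 0")
    case True
    then show ?thesis using assms(1) by (simp add: nc_vanishes_at_0_def)
  next
    case False
    then have "length (drop k w) < length \<alpha>" using Cons.prems that by auto
    then show ?thesis using Cons.IH by simp
  qed
  then show ?case unfolding nc_word.simps nc_mult_def by (intro sum.neutral) simp
qed simp

lemma finite_support_nc_compose:
  fixes G :: "'n::finite \<Rightarrow> 'n ncfps"
  assumes "nc_vanishes_at_0 G"
  shows "finite {\<alpha>. H \<alpha> * nc_word G \<alpha> w \<noteq> 0}"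
proof (rule finite_subset)
  show "{\<alpha>. H \<alpha> * nc_word G \<alpha> w \<noteq> 0} \<subseteq> {\<alpha>. set \<alpha> \<subseteq> UNIV \<and> length \<alpha> \<le> length w}"
    using nc_word_eq_0[OF assms] by (force simp: not_le[symmetric])
  show "finite {\<alpha> :: 'n list. set \<alpha> \<subseteq> UNIV \<and> length \<alpha> \<le> length w}"
    by (rule finite_lists_length_le) simp
qed

end

theory Submission
  imports Defs
begin

text \<open>
  If \<open>J\<close> is the Jacobian of \<open>F\<close>, then for \<open>w \<noteq> []\<close> the coefficient of \<open>F \<circ> G\<close> at \<open>w\<close> is
  \<open>J\<close> applied to the coefficients of \<open>G\<close> at \<open>w\<close>, plus contributions of words of length at
  least 2, which involve coefficients of \<open>G\<close> at words shorter than \<open>w\<close> only. So if \<open>J\<close> is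
  invertible, \<open>F \<circ> G = T\<close> is a recursion on the length of words and has exactly one solution \<open>G\<close>,
  for every \<open>T\<close> with \<open>T 0 = 0\<close>. If \<open>F \<circ> G = id\<close>, then both \<open>G \<circ> F\<close> and \<open>id\<close> solve
  \<open>F \<circ> X = F\<close>, hence they are equal. Conversely, the coefficients of \<open>F \<circ> G = id\<close> at words of
  length 1 say that the product of the two Jacobians is the identity matrix.
\<close>

subsection \<open>The algebra of formal power series\<close>

text \<open>Factorizations are pairs of words instead of cut positions, so that nested sums can be
  reindexed by explicit bijections without \<open>take\<close>/\<open>drop\<close>
  arithmetic.\<close>

definition splits :: "'a list \<Rightarrow> ('a list \<times> 'a list) set" where
  "splits w = {(u, v). u @ v = w}"

lemma mem_splits [simp]: "(u, v) \<in> splits w \<longleftrightarrow> u @ v = w"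
  by (simp add: splits_def)

lemma bij_betw_splits: "bij_betw (\<lambda>k. (take k w, drop k w)) {..length w} (splits w)"
  by (rule bij_betw_byWitness[where f' = "\<lambda>(u, v). length u"]) (auto simp: splits_def)

lemma finite_splits [simp]: "finite (splits w)"
  using bij_betw_finite[OF bij_betw_splits, of w] by simp

lemma nc_mult_splits: "nc_mult f g w = (\<Sum>(u, v)\<in>splits w. f u * g v)"
  unfolding nc_mult_def
  using sum.reindex_bij_betw[OF bij_betw_splits, of "\<lambda>(u, v). f u * g v" w] by simp

lemma nc_mult_assoc: "nc_mult (nc_mult f g) h = nc_mult f (nc_mult g h)"
proof
  fix w
  have "nc_mult (nc_mult f g) h w =
      (\<Sum>(x, y)\<in>Sigma (splits w) (\<lambda>x. splits (fst x)). f (fst y) * g (snd y) * h (snd x))"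
    by (simp add: nc_mult_splits split_def sum_distrib_right sum.Sigma)
  also have "\<dots> =
      (\<Sum>(x, y)\<in>Sigma (splits w) (\<lambda>x. splits (snd x)). f (fst x) * (g (fst y) * h (snd y)))"
    \<comment> \<open>Both sums run over the factorizations of \<open>w\<close> into three words,
      bracketed differently.\<close>
    by (rule sum.reindex_bij_witness
        [where i = "\<lambda>((a, q), (b, c)). ((a @ b, c), (a, b))"
           and j = "\<lambda>((p, c), (a, b)). ((a, b @ c), (b, c))"]) auto
  also have "\<dots> = nc_mult f (nc_mult g h) w"
    by (simp add: nc_mult_splits split_def sum_distrib_left sum.Sigma)
  finally show "nc_mult (nc_mult f g) h w = nc_mult f (nc_mult g h) w" .
qed

lemma nc_mult_one_left [simp]: "nc_mult nc_one f = f"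
proof
  fix w
  have "nc_mult nc_one f w = (\<Sum>k\<le>length w. if k = 0 then f w else 0)"
    unfolding nc_mult_def by (intro sum.cong) (auto simp: nc_one_def)
  then show "nc_mult nc_one f w = f w" by simp
qed

lemma nc_mult_one_right [simp]: "nc_mult f nc_one = f"
proof
  fix w
  have "nc_mult f nc_one w = (\<Sum>k\<le>length w. if k = length w then f w else 0)"
    unfolding nc_mult_def by (intro sum.cong) (auto simp: nc_one_def)
  then show "nc_mult f nc_one w = f w" by simp
qed

lemma nc_word_append: "nc_word G (u @ v) = nc_mult (nc_word G u) (nc_word G v)"
  by (induction u) (simp_all add: nc_mult_assoc)

lemma nc_id_apply: "nc_id i w = (if w = [i] then 1 else 0)"
  by (simp add: nc_id_def nc_var_def)

lemma nc_vanishes_at_0_id: "nc_vanishes_at_0 nc_id"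
  by (simp add: nc_vanishes_at_0_def nc_id_apply)

lemma nc_word_id: "nc_word nc_id \<alpha> w = (if w = \<alpha> then 1 else 0)"
proof (induction \<alpha> arbitrary: w)
  case Nil
  then show ?case by (simp add: nc_one_def)
next
  case (Cons i \<alpha>)
  have "nc_word nc_id (i # \<alpha>) w = (\<Sum>x\<in>splits w. if x = ([i], \<alpha>) then 1 else 0)"
    unfolding nc_word.simps nc_mult_splits
    by (intro sum.cong) (auto simp: Cons.IH nc_id_apply split: if_splits)
  also have "\<dots> = (if w = i # \<alpha> then 1 else 0)" by (simp add: sum.delta)
  finally show ?case .
qed

text \<open>
  The other letters of \<open>\<alpha>\<close> take up at least one letter of \<open>w\<close> each, so a single factor sees
  subwords of length at most \<open>length w + 1 - length \<alpha>\<close> only.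
\<close>

lemma nc_word_cong_short:
  assumes "nc_vanishes_at_0 A" "nc_vanishes_at_0 B"
    and "\<And>i v. length v + length \<alpha> \<le> Suc (length w) \<Longrightarrow> A i v = B i v"
  shows "nc_word A \<alpha> w = nc_word B \<alpha> w"
  using assms(3)
proof (induction \<alpha> arbitrary: w)
  case (Cons i \<alpha>)
  have "A i (take k w) * nc_word A \<alpha> (drop k w) = B i (take k w) * nc_word B \<alpha> (drop k w)"
    if k: "k \<le> length w" for k
  \<comment> \<open>In the first case both products vanish. Otherwise the head takes at least one
    letter of \<open>w\<close>, which makes up for the letter lost from the word in the length
    bound.\<close>
  proof (cases "k = 0 \<or> length (drop k w) < length \<alpha>")
    case True
    then show ?thesis
      using assms(1,2) nc_word_eq_0[of _ "drop k w" \<alpha>] by (auto simp: nc_vanishes_at_0_def)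
  next
    case False
    have "A i (take k w) = B i (take k w)"
      by (rule Cons.prems) (use False k in auto)
    moreover have "nc_word A \<alpha> (drop k w) = nc_word B \<alpha> (drop k w)"
      by (rule Cons.IH, rule Cons.prems) (use False k in auto)
    ultimately show ?thesis by simp
  qed
  then show ?case by (simp add: nc_mult_def)
qed simp

subsection \<open>Composition\<close>

lemma finite_words_le [simp]: "finite {\<alpha> :: 'n::finite list. length \<alpha> \<le> N}"
  using finite_lists_length_le[of "UNIV :: 'n set" N] by simp

text \<open>The bound \<open>N\<close> is left free so that coefficients at different words share
  one finite index set and sums can be exchanged.\<close>

lemma nc_compose1_eq_sum:
  fixes G :: "'n::finite \<Rightarrow> 'n ncfps"
  assumes "nc_vanishes_at_0 G" "length w \<le> N"
  shows "nc_compose1 H G w = (\<Sum>\<alpha> | length \<alpha> \<le> N. H \<alpha> * nc_word G \<alpha> w)"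
  unfolding nc_compose1_def
proof (rule Sum_any.expand_superset)
  show "{\<alpha>. H \<alpha> * nc_word G \<alpha> w \<noteq> 0} \<subseteq> {\<alpha>. length \<alpha> \<le> N}"
    using nc_word_eq_0[OF assms(1)] assms(2) by (force simp: not_le[symmetric])
qed simp

lemma nc_compose1_Nil:
  fixes G :: "'n::finite \<Rightarrow> 'n ncfps"
  assumes "nc_vanishes_at_0 G"
  shows "nc_compose1 H G [] = H []"
  using nc_compose1_eq_sum[OF assms, of "[]" 0 H] by (simp add: nc_one_def)

lemma nc_compose1_linear_part:
  fixes G :: "'n::finite \<Rightarrow> 'n ncfps"
  assumes "nc_vanishes_at_0 G" "w \<noteq> []"
  shows "nc_compose1 H G w = (\<Sum>j\<in>UNIV. H [j] * G j w) +
    (\<Sum>\<alpha> | 2 \<le> length \<alpha> \<and> length \<alpha> \<le> length w. H \<alpha> * nc_word G \<alpha> w)"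
proof -
  let ?h = "\<lambda>\<alpha>. H \<alpha> * nc_word G \<alpha> w"
  let ?S = "range (\<lambda>j :: 'n. [j])"
  let ?L = "{\<alpha> :: 'n list. 2 \<le> length \<alpha> \<and> length \<alpha> \<le> length w}"
  have fin: "finite ?L" by (rule finite_subset[OF _ finite_words_le[of "length w"]]) auto
  have "{\<alpha> :: 'n list. length \<alpha> \<le> length w} = insert [] (?S \<union> ?L)" (is "?l = ?r")
  proof (rule set_eqI)
    fix \<alpha> :: "'n list"
    have "length w \<ge> 1" using assms(2) by (cases w) auto
    then show "\<alpha> \<in> ?l \<longleftrightarrow> \<alpha> \<in> ?r"
      \<comment> \<open>The rule serves as a case split into words of length 0, 1 and at least
        2.\<close>
      by (cases \<alpha> rule: remdups_adj.cases) auto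
  qed
  then have "nc_compose1 H G w = sum ?h (insert [] (?S \<union> ?L))"
    using nc_compose1_eq_sum[OF assms(1) order_refl, of H w] by simp
  also have "\<dots> = sum ?h (?S \<union> ?L)"
    using fin assms(2) by (subst sum.insert) (auto simp: nc_one_def)
  also have "\<dots> = sum ?h ?S + sum ?h ?L"
    using fin by (subst sum.union_disjoint) auto
  also have "sum ?h ?S = (\<Sum>j\<in>UNIV. H [j] * G j w)"
    by (subst sum.reindex) (auto simp: inj_on_def)
  finally show ?thesis .
qed

section \<open>Monoid laws of composition\<close>

lemma nc_compose_vanishes:
  fixes G :: "'n::finite \<Rightarrow> 'n ncfps"
  assumes "nc_vanishes_at_0 F" "nc_vanishes_at_0 G"
  shows "nc_vanishes_at_0 (nc_compose F G)"
  using assms by (simp add: nc_vanishes_at_0_def nc_compose_def nc_compose1_Nil)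

lemma nc_compose_id_left: "nc_compose nc_id F = F"
proof (intro ext)
  fix i w
  have "nc_compose nc_id F i w = Sum_any (\<lambda>\<alpha>. if \<alpha> = [i] then nc_word F \<alpha> w else 0)"
    unfolding nc_compose_def nc_compose1_def nc_id_def nc_var_def
    by (rule arg_cong[where f = Sum_any]) auto
  also have "\<dots> = nc_word F [i] w"
    by (subst Sum_any.expand_superset[where A = "{[i]}"]) auto
  finally show "nc_compose nc_id F i w = F i w" by simp
qed

lemma nc_compose_id_right: "nc_compose F nc_id = F"
proof (intro ext)
  fix i w
  have "nc_compose F nc_id i w = Sum_any (\<lambda>\<alpha>. if w = \<alpha> then F i w else 0)"
    unfolding nc_compose_def nc_compose1_def nc_word_id
    by (rule arg_cong[where f = Sum_any]) auto
  then show "nc_compose F nc_id i w = F i w"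
    by (subst (asm) Sum_any.expand_superset[where A = "{w}"]) auto
qed

lemma nc_compose1_one:
  fixes G :: "'n::finite \<Rightarrow> 'n ncfps"
  shows "nc_compose1 nc_one G = nc_one"
proof
  fix w
  have "nc_compose1 nc_one G w = Sum_any (\<lambda>\<alpha>. if \<alpha> = [] then nc_word G \<alpha> w else 0)"
    unfolding nc_compose1_def by (rule arg_cong[where f = Sum_any]) (auto simp: nc_one_def)
  also have "\<dots> = nc_word G [] w"
    by (subst Sum_any.expand_superset[where A = "{[]}"]) auto
  finally show "nc_compose1 nc_one G w = nc_one w" by simp
qed

lemma nc_compose1_mult:
  fixes G :: "'n::finite \<Rightarrow> 'n ncfps"
  assumes G: "nc_vanishes_at_0 G"
  shows "nc_compose1 (nc_mult A B) G = nc_mult (nc_compose1 A G) (nc_compose1 B G)"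
proof
  fix w :: "'n list"
  let ?N = "length w"
  let ?L = "{\<alpha> :: 'n list. length \<alpha> \<le> ?N}"
  let ?t = "\<lambda>(u, v). A u * B v * nc_word G (u @ v) w"
  have "nc_compose1 (nc_mult A B) G w = (\<Sum>\<gamma>\<in>?L. \<Sum>(u, v)\<in>splits \<gamma>. A u * B v * nc_word G \<gamma> w)"
    by (simp add: nc_compose1_eq_sum[OF G order_refl] nc_mult_splits sum_distrib_right split_def)
  also have "\<dots> = (\<Sum>(\<gamma>, u, v)\<in>Sigma ?L splits. A u * B v * nc_word G \<gamma> w)"
    by (simp add: sum.Sigma split_def)
  also have "\<dots> = sum ?t {(u, v). length u + length v \<le> ?N}"
    by (rule sum.reindex_bij_witness
        [where i = "\<lambda>(u, v). (u @ v, u, v)" and j = "\<lambda>(\<gamma>, u, v). (u, v)"]) auto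
  also have "\<dots> = sum ?t (?L \<times> ?L)"
  \<comment> \<open>The added pairs have joint length above \<open>?N\<close>, and such words in
    \<open>G\<close> have coefficient 0 at \<open>w\<close>. The square index set lets the sum
    factor.\<close>
  proof (rule sum.mono_neutral_left)
    show "\<forall>x\<in>?L \<times> ?L - {(u, v). length u + length v \<le> ?N}. ?t x = 0"
      using nc_word_eq_0[OF G] by (force simp: not_le)
  qed auto
  also have "\<dots> = (\<Sum>u\<in>?L. \<Sum>v\<in>?L. ?t (u, v))"
    by (simp add: sum.cartesian_product)
  also have "\<dots> = (\<Sum>u\<in>?L. \<Sum>v\<in>?L. \<Sum>k\<le>?N.
      (A u * nc_word G u (take k w)) * (B v * nc_word G v (drop k w)))"
    by (simp add: nc_word_append nc_mult_def sum_distrib_left mult_ac)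
  also have "\<dots> = (\<Sum>u\<in>?L. \<Sum>k\<le>?N. \<Sum>v\<in>?L.
      (A u * nc_word G u (take k w)) * (B v * nc_word G v (drop k w)))"
    by (intro sum.cong refl sum.swap)
  also have "\<dots> = (\<Sum>k\<le>?N. \<Sum>u\<in>?L. \<Sum>v\<in>?L.
      (A u * nc_word G u (take k w)) * (B v * nc_word G v (drop k w)))"
    by (rule sum.swap)
  also have "\<dots> = (\<Sum>k\<le>?N. nc_compose1 A G (take k w) * nc_compose1 B G (drop k w))"
    by (intro sum.cong refl)
      (simp add: sum_product nc_compose1_eq_sum[OF G, where N = ?N])
  finally show "nc_compose1 (nc_mult A B) G w = nc_mult (nc_compose1 A G) (nc_compose1 B G) w"
    by (simp add: nc_mult_def)
qed

lemma nc_word_compose: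
  fixes H :: "'n::finite \<Rightarrow> 'n ncfps"
  assumes "nc_vanishes_at_0 H"
  shows "nc_word (nc_compose G H) \<alpha> = nc_compose1 (nc_word G \<alpha>) H"
  by (induction \<alpha>) (simp_all add: nc_compose1_one nc_compose1_mult[OF assms] nc_compose_def)

text \<open>Substitution of \<open>H\<close> is multiplicative, hence commutes with forming words in
  \<open>G\<close>; what remains is an exchange of two finite sums.\<close>

lemma nc_compose_assoc:
  fixes G H :: "'n::finite \<Rightarrow> 'n ncfps"
  assumes G: "nc_vanishes_at_0 G" and H: "nc_vanishes_at_0 H"
  shows "nc_compose (nc_compose F G) H = nc_compose F (nc_compose G H)"
proof (intro ext)
  fix i and w :: "'n list"
  let ?L = "{\<alpha> :: 'n list. length \<alpha> \<le> length w}"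
  have "nc_compose (nc_compose F G) H i w =
      (\<Sum>\<beta>\<in>?L. \<Sum>\<alpha>\<in>?L. F i \<alpha> * nc_word G \<alpha> \<beta> * nc_word H \<beta> w)"
    unfolding nc_compose_def nc_compose1_eq_sum[OF H order_refl]
    by (intro sum.cong refl)
      (simp add: nc_compose1_eq_sum[OF G, where N = "length w"] sum_distrib_right)
  also have "\<dots> = (\<Sum>\<alpha>\<in>?L. \<Sum>\<beta>\<in>?L. F i \<alpha> * nc_word G \<alpha> \<beta> * nc_word H \<beta> w)"
    by (rule sum.swap)
  also have "\<dots> = nc_compose1 (F i) (nc_compose G H) w"
    by (simp add: nc_compose1_eq_sum[OF nc_compose_vanishes[OF G H] order_refl]
        nc_word_compose[OF H] nc_compose1_eq_sum[OF H order_refl] sum_distrib_left mult.assoc)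
  finally show "nc_compose (nc_compose F G) H i w = nc_compose F (nc_compose G H) i w"
    by (simp add: nc_compose_def)
qed

subsection \<open>Inversion\<close>

lemma length_recursion_ex1:
  fixes S :: "('i \<Rightarrow> 'a list \<Rightarrow> 'b) \<Rightarrow> 'i \<Rightarrow> 'a list \<Rightarrow> 'b"
  assumes S: "\<And>A B i w. (\<And>j v. length v < length w \<Longrightarrow> A j v = B j v) \<Longrightarrow> S A i w = S B i w"
  shows "\<exists>!G. S G = G"
proof -
  \<comment> \<open>The measure ignores the index, since \<open>S A i w\<close> may consult every
    component of \<open>A\<close> at shorter words.\<close>
  let ?R = "Wellfounded.measure (length \<circ> snd) :: (('i \<times> 'a list) \<times> ('i \<times> 'a list)) set"
  define T where "T f = case_prod (S (curry f))" for f :: "'i \<times> 'a list \<Rightarrow> 'b"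
  have "adm_wf ?R T"
    unfolding adm_wf_def T_def by (auto intro!: S)
  then have "wfrec ?R T = T (wfrec ?R T)"
    by (intro wfrec_fixpoint) simp
  then have "curry (T (wfrec ?R T)) = curry (wfrec ?R T)" by simp
  then have "S (curry (wfrec ?R T)) = curry (wfrec ?R T)" by (simp add: T_def)
  moreover have "A = B" if "S A = A" "S B = B" for A B
  proof -
    have "\<forall>i. A i w = B i w" for w
    proof (induction w rule: length_induct)
      case (1 w)
      then show ?case using S[of w A B] that by auto
    qed
    then show ?thesis by (intro ext) simp
  qed
  ultimately show ?thesis by blast
qed

lemma nc_compose_eq_ex1:
  fixes F T :: "'n::finite \<Rightarrow> 'n ncfps"
  assumes F: "nc_vanishes_at_0 F" and T: "nc_vanishes_at_0 T"
    and det: "det (nc_jacobian_0 F) \<noteq> 0"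
  shows "\<exists>!G. nc_vanishes_at_0 G \<and> nc_compose F G = T"
proof -
  let ?J = "nc_jacobian_0 F"
  have "invertible ?J" using det by (simp add: invertible_det_nz)
  then obtain K where K: "?J ** K = mat 1" "K ** ?J = mat 1"
    unfolding invertible_def by blast
  \<comment> \<open>The recursion must make sense for arbitrary families, whereas
    \<open>nc_word_cong_short\<close> needs vanishing constant coefficients; truncation enforces
    them.\<close>
  define trunc :: "('n \<Rightarrow> 'n ncfps) \<Rightarrow> 'n \<Rightarrow> 'n ncfps"
    where "trunc A = (\<lambda>i v. if v = [] then 0 else A i v)" for A
  \<comment> \<open>The coefficient vector of a solution at a nonempty \<open>w\<close> solves the
    linear system with matrix \<open>?J\<close> and right-hand side \<open>R A w\<close>. The value
    0 of \<open>S\<close> at \<open>[]\<close> makes every fixed point vanish at 0.\<close>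
  define R :: "('n \<Rightarrow> 'n ncfps) \<Rightarrow> 'n list \<Rightarrow> complex ^ 'n"
    where "R A w = (\<chi> i. T i w -
      (\<Sum>\<alpha> | 2 \<le> length \<alpha> \<and> length \<alpha> \<le> length w. F i \<alpha> * nc_word (trunc A) \<alpha> w))" for A w
  define S where "S A = (\<lambda>i w. if w = [] then 0 else (K *v R A w) $ i)" for A
  have trunc_vanishes: "nc_vanishes_at_0 (trunc A)" for A
    by (simp add: trunc_def nc_vanishes_at_0_def)
  have trunc_eq: "trunc G = G" if "nc_vanishes_at_0 G" for G
    using that by (auto simp: trunc_def nc_vanishes_at_0_def fun_eq_iff)
  have J: "?J *v x = y \<longleftrightarrow> K *v y = x" for x y
    using K by (auto simp: matrix_vector_mul_assoc)
  have "\<exists>!G. S G = G"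
  proof (rule length_recursion_ex1)
    fix A B :: "'n \<Rightarrow> 'n ncfps" and i and w :: "'n list"
    assume "\<And>j v. length v < length w \<Longrightarrow> A j v = B j v"
    \<comment> \<open>With at least two letters in \<alpha>, the bound of
      \<open>nc_word_cong_short\<close> leaves only words strictly shorter than
      \<open>w\<close>.\<close>
    then have "nc_word (trunc A) \<alpha> w = nc_word (trunc B) \<alpha> w" if "2 \<le> length \<alpha>" for \<alpha>
      using that by (intro nc_word_cong_short trunc_vanishes) (auto simp: trunc_def)
    then have "R A w = R B w" by (simp add: R_def)
    then show "S A i w = S B i w" by (simp add: S_def)
  qed
  moreover have "nc_vanishes_at_0 G \<and> nc_compose F G = T \<longleftrightarrow> S G = G" for G
  proof (cases "nc_vanishes_at_0 G")
    case False
    then obtain i where "G i [] \<noteq> 0" by (auto simp: nc_vanishes_at_0_def)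
    moreover have "S G i [] = 0" by (simp add: S_def)
    ultimately show ?thesis using False by auto
  next
    case True
    have Nil: "nc_compose F G i [] = T i [] \<and> S G i [] = G i []" for i
      using F T True by (simp add: nc_compose_def nc_compose1_Nil nc_vanishes_at_0_def S_def)
    have "(\<forall>i. nc_compose F G i w = T i w) \<longleftrightarrow> (\<forall>i. S G i w = G i w)" for w
    proof (cases "w = []")
      case True
      then show ?thesis using Nil by simp
    next
      case w: False
      have "(\<forall>i. nc_compose F G i w = T i w) \<longleftrightarrow> ?J *v (\<chi> j. G j w) = R G w"
        by (simp add: nc_compose_def nc_compose1_linear_part[OF True w] R_def trunc_eq[OF True]
            vec_eq_iff matrix_vector_mult_def nc_jacobian_0_def algebra_simps)
      also have "\<dots> \<longleftrightarrow> (\<forall>i. S G i w = G i w)"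
        unfolding J by (simp add: S_def w vec_eq_iff)
      finally show ?thesis .
    qed
    then show ?thesis using True by (auto simp: fun_eq_iff)
  qed
  ultimately show ?thesis by simp
qed

lemma nc_right_inverse_imp:
  fixes F G :: "'n::finite \<Rightarrow> 'n ncfps"
  assumes G: "nc_vanishes_at_0 G" and FG: "nc_compose F G = nc_id"
  shows "nc_vanishes_at_0 F" and "det (nc_jacobian_0 F) \<noteq> 0"
proof -
  have FG': "nc_compose1 (F i) G w = nc_id i w" for i w
    using FG by (metis nc_compose_def)
  show "nc_vanishes_at_0 F"
    using FG'[of _ "[]"] by (simp add: nc_vanishes_at_0_def nc_compose1_Nil[OF G] nc_id_apply)
  \<comment> \<open>At words of length 1 only the linear part of the composition survives, which is
    an entry of the product of the Jacobians.\<close>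
  have no_long: "{\<alpha> :: 'n list. 2 \<le> length \<alpha> \<and> length \<alpha> \<le> Suc 0} = {}" by auto
  have "(\<Sum>k\<in>UNIV. F i [k] * G k [j]) = (if i = j then 1 else 0)" for i j
    using FG'[of i "[j]"] by (auto simp: nc_compose1_linear_part[OF G] no_long nc_id_apply)
  then have "nc_jacobian_0 F ** nc_jacobian_0 G = mat 1"
    by (simp add: matrix_matrix_mult_def nc_jacobian_0_def mat_def vec_eq_iff)
  then have "det (nc_jacobian_0 F) * det (nc_jacobian_0 G) = 1"
    by (metis det_I det_mul)
  then show "det (nc_jacobian_0 F) \<noteq> 0" by auto
qed

lemma nc_right_inverse_is_left_inverse:
  fixes F G :: "'n::finite \<Rightarrow> 'n ncfps"
  assumes G: "nc_vanishes_at_0 G" and FG: "nc_compose F G = nc_id"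
  shows "nc_compose G F = nc_id"
proof -
  note F = nc_right_inverse_imp[OF assms]
  have "nc_compose F (nc_compose G F) = F"
    by (simp add: nc_compose_assoc[OF G F(1), symmetric] FG nc_compose_id_left)
  \<comment> \<open>Uniqueness is applied with target \<open>F\<close>, which cancels
    \<open>F\<close> on the left.\<close>
  then show ?thesis
    using nc_compose_eq_ex1[OF F(1) F(1) F(2)] nc_compose_vanishes[OF G F(1)]
      nc_vanishes_at_0_id nc_compose_id_right
    by blast
qed

theorem theorem1p3:
  fixes F :: "'n::finite \<Rightarrow> 'n ncfps"
  shows "((\<exists>G. nc_vanishes_at_0 G \<and> nc_compose F G = nc_id) \<longleftrightarrow>
            (nc_vanishes_at_0 F \<and> det (nc_jacobian_0 F) \<noteq> 0))
       \<and> (nc_vanishes_at_0 F \<and> det (nc_jacobian_0 F) \<noteq> 0 \<longrightarrow>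
            (\<exists>!G. nc_vanishes_at_0 G \<and> nc_compose F G = nc_id) \<and>
            (\<forall>G. nc_vanishes_at_0 G \<and> nc_compose F G = nc_id \<longrightarrow> nc_compose G F = nc_id))"
proof -
  have "\<exists>!G. nc_vanishes_at_0 G \<and> nc_compose F G = nc_id"
    if "nc_vanishes_at_0 F" "det (nc_jacobian_0 F) \<noteq> 0"
    using nc_compose_eq_ex1 nc_vanishes_at_0_id that by blast
  then show ?thesis
    using nc_right_inverse_imp nc_right_inverse_is_left_inverse by blast
qed

end
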